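(* (i) There exist a signature $S$, an $S$-database $D$ and a collection $\bar{\mathcal{D}}$ of updates over $D$ for which there are tautologies $\phi$ with $I_{\bar{\mathcal{D}}}(\phi)=0$ and there are also tautologies $\psi$ with $I_{\bar{\mathcal{D}}}(\psi)>0$. (ii) In contrast, for every signature $S$, every $S$-database $D$, every collection $\bar{\mathcal{D}}$ of updates over $D$ and every contradiction $\phi$, $I_{\bar{\mathcal{D}}}(\phi)=0$.
   Context: **Conventions.** Propositions are classical first-order sentences. A tautology is a logically valid sentence, a contradiction is an unsatisfiable one. Signatures consist of constants (the symbols of arity $0$) and relation/function symbols of arity $>0$. $A(\sigma)$ is the interpretation of the symbol $\sigma$ in the structure $A$. $A(\phi)=1$ means that $\phi$ is true in $A$ (which requires that $A$ interprets all symbols of $\phi$). **Databases.** An $S$-database is a pair $D=(A,T)$ where $A$ is a finite first-order structure over $S$ and $T$ is a finite classical first-order theory over $S$ with $A(\phi)=1$ for all $\phi\in T$. **Insertion.** An insertion of an $n$-ary symbol $\sigma$ into an $S$-database $D=(A,T)$ is a database $D'=(A',T)$, with $A'$ a structure over $S'=S\cup\{\sigma\}$, such that: (1) $A'(\tau)=A(\tau)$ for all $\tau\in S$, $\tau\neq\sigma$; (2) if $n=0$ and $\sigma\in S$, then $dom(A')=dom(A)$ and $A'(\sigma)=A(\sigma)$; if $n=0$ and $\sigma\notin S$, then $dom(A')=dom(A)\cup\{a\}$ and $A'(\sigma)=a$ for some object $a$ (possibly already in $dom(A)$); (3) if $n>0$, then $dom(A')=dom(A)\cup\{a_1,\ldots,a_n\}$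 and $A'(\sigma)=A(\sigma)\cup\{(a_1,\ldots,a_n)\}$ for some objects $a_1,\ldots,a_n$ (with $A(\sigma)$ read as empty if $\sigma\notin S$); in all cases provided $A'(\phi)=1$ for all $\phi\in T$. **Deletion.** An element $a\in dom(A)$ is free for $\sigma\in S$ if there is no constant $\tau\in S$, $\tau\ne\sigma$, with $A(\tau)=a$, and no symbol $\delta\neq\sigma$ of arity $m>0$ with a tuple $(b_1,\ldots,b_m)\in A(\delta)$ such that $a=b_i$ for some $i$. A deletion of an $n$-ary symbol $\sigma$ from $D=(A,T)$ is a database $D'=(A',T)$, with $A'$ a structure over $S'$, where $S'=S$ or $S'=S-\{\sigma\}$, such that: (1) $A'(\tau)=A(\tau)$ for all $\tau\in S-\{\sigma\}$; (2) if $n=0$ and $S'=S$, then $dom(A')=dom(A)$ and $A'(\sigma)=a$ for some $a\in dom(A)$ with $a\neq A(\sigma)$; if $n=0$ and $S'=S-\{\sigma\}$, then $dom(A')=dom(A)-\{A(\sigma)\}$ if $A(\sigma)$ is free for $\sigma$, and $dom(A')=dom(A)$ otherwise; (3) if $n>0$ and $S'=S$, then $dom(A')=dom(A)$ and $A'(\sigma)=A(\sigma)-\{(a_1,\ldots,a_n)\}$ for some tuple; if $n>0$ and $S'=S-\{\sigma\}$, then $dom(A')=dom(A)-\{c_1,\ldots,c_k\}$, where each $c_i$ is an entry of some tuple of $A(\sigma)$ and is free for $\sigma$; in all cases provided $A'(\phi)=1$ for all $\phi\in T$. **Updates.** An update of (or over) $D$ is an at most enumerable sequence $\mathcal{D}=(D_i:i<\alpha)$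 with $D_0=D$ and each $D_{i+1}$ an insertion into or a deletion from $D_i$ (of some symbol). Write $D_i=(A_i,T)$. $\mathcal{D}$ is satisfactory for $\phi$, written $\mathcal{D}(\phi)=1$, if $\alpha=n+1$ for some $n\in\mathbb{N}$ and $A_n(\phi)=1$; otherwise it is unsatisfactory for $\phi$, written $\mathcal{D}(\phi)=0$. If $\mathcal{D}=(D_i:i<n)$ is satisfactory for $\phi$, put $\|\mathcal{D}\|=\min\{i<n: A_i(\phi)=1\}$ (this depends on $\phi$). **Complexity.** For a collection $\bar{\mathcal{D}}$ of updates over $D$, $C_{\bar{\mathcal{D}}}(\phi)=\min\{\|\mathcal{D}\|:\mathcal{D}\in\bar{\mathcal{D}},\ \mathcal{D}(\phi)=1\}$ if some $\mathcal{D}\in\bar{\mathcal{D}}$ is satisfactory for $\phi$, and $C_{\bar{\mathcal{D}}}(\phi)=0$ otherwise. $C_{\bar{\mathcal{D}}}(\{\phi_0,\ldots,\phi_n\})=\sum_{i=0}^n C_{\bar{\mathcal{D}}}(\phi_i)$, and the complexity $C_{\bar{\mathcal{D}}}(\phi_0,\ldots,\phi_n)$ of a deduction is that of the set $\{\phi_0,\ldots,\phi_n\}$. **Relevancy.** A deduction is a finite sequence of propositions $\phi_0,\ldots,\phi_n$ whose first propositions $\phi_0,\ldots,\phi_k$ ($k\le n$) are its premisses and whose last proposition $\phi_n$ is its conclusion; it is valid if the premisses imply the conclusion. Its support is the set $\{\phi_0,\ldots,\phi_k\}\cup\{\phi_n\}$, written $\{\phi_0,\ldots,\phi_k\}\{\phi_n\}$.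 For an update $\mathcal{D}$ of $D=(A,T)$ and a finite set $\Gamma$ of formulas, $\mathcal{D}(\Gamma)=\{\phi\in\Gamma:\mathcal{D}(\phi)=1\text{ and }T\nvDash\phi\}$, where $T\nvDash\phi$ means that $\phi$ is not a logical consequence of $T$. If the deduction is valid and some update in $\bar{\mathcal{D}}$ is satisfactory for $\phi_n$, then $$R_{\bar{\mathcal{D}}}(\phi_0,\ldots,\phi_n)=\frac{|\mathcal{D}(\{\phi_0,\ldots,\phi_k\}\{\phi_n\})|}{|\{\phi_0,\ldots,\phi_k\}\{\phi_n\}|},$$ where $\mathcal{D}$ is the smallest (least length) update in $\bar{\mathcal{D}}$ satisfactory for $\phi_n$; otherwise $R_{\bar{\mathcal{D}}}(\phi_0,\ldots,\phi_n)=0$. **Semantic informativity.** $I_{\bar{\mathcal{D}}}(\phi_0,\ldots,\phi_n)=C_{\bar{\mathcal{D}}}(\phi_0,\ldots,\phi_n)\cdot R_{\bar{\mathcal{D}}}(\phi_0,\ldots,\phi_n)$. For a single proposition $\phi$, $I_{\bar{\mathcal{D}}}(\phi)$ is the informativity of the one-term deduction $\phi$ (with $\phi$ as premiss and conclusion, so its support is $\{\phi\}$).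
   Formalization: T⊭φ is read as: some S-structure satisfying T fails to satisfy φ, which includes any φ with symbols outside S; under ordinary consequence every tautology would have I=0 and (i) would be false. Validity ranges over structures in one infinite universe (equivalent by Löwenheim–Skolem). *)

theory Defs
  imports Complex_Main "HOL-Library.Infinite_Typeclass"
begin

section \<open>First-order syntax\<close>

text \<open>A symbol carries its kind and its number of argument places. Constants are the symbols of
  arity 0; a signature is any set of symbols in which relation and function symbols have positive
  arity.\<close>

datatype 's symbol = Cnst 's | Rel 's nat | Fn 's nat

fun proper_symbol :: "'s symbol \<Rightarrow> bool" where
  "proper_symbol (Cnst c) = True"
| "proper_symbol (Rel r n) = (n > 0)"
| "proper_symbol (Fn f n) = (n > 0)"

definition signature :: "'s symbol set \<Rightarrow> bool" where
  "signature S \<longleftrightarrow> (\<forall>\<sigma>\<in>S. proper_symbol \<sigma>)"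

text \<open>The length of the tuples in the interpretation of a non-constant symbol. A function of
  \<open>n\<close> arguments is interpreted by its graph, hence by tuples of length \<open>n + 1\<close>.\<close>

fun width :: "'s symbol \<Rightarrow> nat" where
  "width (Cnst c) = 0"
| "width (Rel r n) = n"
| "width (Fn f n) = Suc n"

datatype 's tm = Var nat | Con 's | App 's "'s tm list"

datatype 's fm =
    Eq "'s tm" "'s tm"
  | Pred 's "'s tm list"
  | Neg "'s fm"
  | Conj "'s fm" "'s fm"
  | Disj "'s fm" "'s fm"
  | Imp "'s fm" "'s fm"
  | All nat "'s fm"
  | Ex nat "'s fm"

fun tm_vars :: "'s tm \<Rightarrow> nat set" where
  "tm_vars (Var x) = {x}"
| "tm_vars (Con c) = {}"
| "tm_vars (App f ts) = (\<Union>t\<in>set ts. tm_vars t)"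

fun free_vars :: "'s fm \<Rightarrow> nat set" where
  "free_vars (Eq s t) = tm_vars s \<union> tm_vars t"
| "free_vars (Pred r ts) = (\<Union>t\<in>set ts. tm_vars t)"
| "free_vars (Neg \<phi>) = free_vars \<phi>"
| "free_vars (Conj \<phi> \<psi>) = free_vars \<phi> \<union> free_vars \<psi>"
| "free_vars (Disj \<phi> \<psi>) = free_vars \<phi> \<union> free_vars \<psi>"
| "free_vars (Imp \<phi> \<psi>) = free_vars \<phi> \<union> free_vars \<psi>"
| "free_vars (All x \<phi>) = free_vars \<phi> - {x}"
| "free_vars (Ex x \<phi>) = free_vars \<phi> - {x}"

fun tm_symbols :: "'s tm \<Rightarrow> 's symbol set" where
  "tm_symbols (Var x) = {}"
| "tm_symbols (Con c) = {Cnst c}"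
| "tm_symbols (App f ts) = insert (Fn f (length ts)) (\<Union>t\<in>set ts. tm_symbols t)"

fun symbols :: "'s fm \<Rightarrow> 's symbol set" where
  "symbols (Eq s t) = tm_symbols s \<union> tm_symbols t"
| "symbols (Pred r ts) = insert (Rel r (length ts)) (\<Union>t\<in>set ts. tm_symbols t)"
| "symbols (Neg \<phi>) = symbols \<phi>"
| "symbols (Conj \<phi> \<psi>) = symbols \<phi> \<union> symbols \<psi>"
| "symbols (Disj \<phi> \<psi>) = symbols \<phi> \<union> symbols \<psi>"
| "symbols (Imp \<phi> \<psi>) = symbols \<phi> \<union> symbols \<psi>"
| "symbols (All x \<phi>) = symbols \<phi>"
| "symbols (Ex x \<phi>) = symbols \<phi>"

definition sentence :: "'s fm \<Rightarrow> bool" where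
  "sentence \<phi> \<longleftrightarrow> free_vars \<phi> = {} \<and> signature (symbols \<phi>)"


section \<open>Structures and truth\<close>

text \<open>The values of \<open>con\<close> and \<open>tup\<close> at symbols outside \<open>sig\<close> are meaningless.\<close>

record ('s, 'a) struct =
  sig :: "'s symbol set"
  dom :: "'a set"
  con :: "'s \<Rightarrow> 'a"
  tup :: "'s symbol \<Rightarrow> 'a list set"

hide_const (open) Map.dom

definition structure_over :: "'s symbol set \<Rightarrow> ('s, 'a) struct \<Rightarrow> bool" where
  "structure_over S A \<longleftrightarrow>
     signature S \<and> sig A = S \<and> dom A \<noteq> {} \<and>
     (\<forall>c. Cnst c \<in> S \<longrightarrow> con A c \<in> dom A) \<and>
     (\<forall>r n. Rel r n \<in> S \<longrightarrow>
        (\<forall>as\<in>tup A (Rel r n). length as = n \<and> set as \<subseteq> dom A)) \<and>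
     (\<forall>f n. Fn f n \<in> S \<longrightarrow>
        (\<forall>as\<in>tup A (Fn f n). length as = Suc n \<and> set as \<subseteq> dom A) \<and>
        (\<forall>as. length as = n \<and> set as \<subseteq> dom A \<longrightarrow> (\<exists>!b. as @ [b] \<in> tup A (Fn f n))))"

fun tm_val :: "('s, 'a) struct \<Rightarrow> (nat \<Rightarrow> 'a) \<Rightarrow> 's tm \<Rightarrow> 'a" where
  "tm_val A e (Var x) = e x"
| "tm_val A e (Con c) = con A c"
| "tm_val A e (App f ts) = (THE b. map (tm_val A e) ts @ [b] \<in> tup A (Fn f (length ts)))"

fun sat :: "('s, 'a) struct \<Rightarrow> (nat \<Rightarrow> 'a) \<Rightarrow> 's fm \<Rightarrow> bool" where
  "sat A e (Eq s t) = (tm_val A e s = tm_val A e t)"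
| "sat A e (Pred r ts) = (map (tm_val A e) ts \<in> tup A (Rel r (length ts)))"
| "sat A e (Neg \<phi>) = (\<not> sat A e \<phi>)"
| "sat A e (Conj \<phi> \<psi>) = (sat A e \<phi> \<and> sat A e \<psi>)"
| "sat A e (Disj \<phi> \<psi>) = (sat A e \<phi> \<or> sat A e \<psi>)"
| "sat A e (Imp \<phi> \<psi>) = (sat A e \<phi> \<longrightarrow> sat A e \<psi>)"
| "sat A e (All x \<phi>) = (\<forall>a\<in>dom A. sat A (e(x := a)) \<phi>)"
| "sat A e (Ex x \<phi>) = (\<exists>a\<in>dom A. sat A (e(x := a)) \<phi>)"

text \<open>\<open>A(\<phi>) = 1\<close>; this requires that \<open>A\<close> interprets every symbol of \<open>\<phi>\<close>.\<close>

definition holds :: "('s, 'a) struct \<Rightarrow> 's fm \<Rightarrow> bool" where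
  "holds A \<phi> \<longleftrightarrow> symbols \<phi> \<subseteq> sig A \<and> (\<forall>e. range e \<subseteq> dom A \<longrightarrow> sat A e \<phi>)"

text \<open>Validity, unsatisfiability and consequence quantify over all structures, finite or infinite,
  whose domain is a nonempty subset of the universe of objects \<open>'a\<close>. As \<open>'a\<close> is infinite, the
  Loewenheim-Skolem theorem makes these notions independent of the choice of \<open>'a\<close>.\<close>

definition tautology :: "'a::infinite itself \<Rightarrow> 's fm \<Rightarrow> bool" where
  "tautology _ \<phi> \<longleftrightarrow> sentence \<phi> \<and>
     (\<forall>S (B::('s, 'a) struct). structure_over S B \<and> symbols \<phi> \<subseteq> S \<longrightarrow> holds B \<phi>)"

definition contradiction :: "'a::infinite itself \<Rightarrow> 's fm \<Rightarrow> bool" where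
  "contradiction _ \<phi> \<longleftrightarrow> sentence \<phi> \<and>
     \<not> (\<exists>S (B::('s, 'a) struct). structure_over S B \<and> holds B \<phi>)"

text \<open>Consequence relative to a signature \<open>S\<close>: every \<open>S\<close>-structure satisfying \<open>\<Gamma>\<close> satisfies \<open>\<phi>\<close>.
  For \<open>\<Gamma>\<close> and \<open>\<phi>\<close> over \<open>S\<close> this is ordinary logical consequence. If \<open>\<phi>\<close> contains a symbol outside
  \<open>S\<close>, no \<open>S\<close>-structure satisfies it, so a satisfiable theory over \<open>S\<close> has no such consequence:
  the consequences of an \<open>S\<close>-theory are \<open>S\<close>-sentences. In particular, a tautology with symbols
  outside \<open>S\<close> is not a consequence of a satisfiable \<open>S\<close>-theory.\<close>

definition consequence ::
  "'a::infinite itself \<Rightarrow> 's symbol set \<Rightarrow> 's fm set \<Rightarrow> 's fm \<Rightarrow> bool" where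
  "consequence _ S \<Gamma> \<phi> \<longleftrightarrow>
     (\<forall>B::('s, 'a) struct. structure_over S B \<and> (\<forall>\<chi>\<in>\<Gamma>. holds B \<chi>) \<longrightarrow> holds B \<phi>)"


section \<open>Databases and updates\<close>

type_synonym ('s, 'a) database = "('s, 'a) struct \<times> 's fm set"

definition database :: "'s symbol set \<Rightarrow> ('s, 'a) database \<Rightarrow> bool" where
  "database S D \<longleftrightarrow>
     structure_over S (fst D) \<and> finite (dom (fst D)) \<and>
     finite (snd D) \<and> (\<forall>\<phi>\<in>snd D. sentence \<phi> \<and> symbols \<phi> \<subseteq> S \<and> holds (fst D) \<phi>)"

fun same_interp :: "('s, 'a) struct \<Rightarrow> ('s, 'a) struct \<Rightarrow> 's symbol \<Rightarrow> bool" where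
  "same_interp A A' (Cnst c) = (con A' c = con A c)"
| "same_interp A A' (Rel r n) = (tup A' (Rel r n) = tup A (Rel r n))"
| "same_interp A A' (Fn f n) = (tup A' (Fn f n) = tup A (Fn f n))"

text \<open>The symbol \<open>\<sigma>\<close> need not belong to the signature of \<open>D\<close>. That \<open>D'\<close> is a database includes
  that its structure satisfies the theory.\<close>

definition insertion :: "'s symbol \<Rightarrow> ('s, 'a) database \<Rightarrow> ('s, 'a) database \<Rightarrow> bool" where
  "insertion \<sigma> D D' \<longleftrightarrow>
     (let A = fst D; A' = fst D'; S = sig A in
        snd D' = snd D \<and> database (insert \<sigma> S) D' \<and>
        (\<forall>\<tau>\<in>S. \<tau> \<noteq> \<sigma> \<longrightarrow> same_interp A A' \<tau>) \<and>
        (case \<sigma> of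
           Cnst c \<Rightarrow>
             (if \<sigma> \<in> S then dom A' = dom A \<and> con A' c = con A c
              else \<exists>a. dom A' = dom A \<union> {a} \<and> con A' c = a)
         | _ \<Rightarrow>
             (\<exists>as. length as = width \<sigma> \<and> dom A' = dom A \<union> set as \<and>
                tup A' \<sigma> = (if \<sigma> \<in> S then tup A \<sigma> else {}) \<union> {as})))"

definition free_for :: "('s, 'a) struct \<Rightarrow> 's symbol \<Rightarrow> 'a \<Rightarrow> bool" where
  "free_for A \<sigma> a \<longleftrightarrow>
     \<not> (\<exists>c. Cnst c \<in> sig A \<and> Cnst c \<noteq> \<sigma> \<and> con A c = a) \<and>
     \<not> (\<exists>\<delta>\<in>sig A. \<delta> \<noteq> \<sigma> \<and> width \<delta> > 0 \<and> (\<exists>bs\<in>tup A \<delta>. a \<in> set bs))"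

text \<open>For a non-constant \<open>\<sigma>\<close> that leaves the signature, any set of entries that are free for \<open>\<sigma>\<close>
  may be removed from the domain, as long as the domain does not become empty.\<close>

definition deletion :: "'s symbol \<Rightarrow> ('s, 'a) database \<Rightarrow> ('s, 'a) database \<Rightarrow> bool" where
  "deletion \<sigma> D D' \<longleftrightarrow>
     (let A = fst D; A' = fst D'; S = sig A; S' = sig A' in
        \<sigma> \<in> S \<and> (S' = S \<or> S' = S - {\<sigma>}) \<and>
        snd D' = snd D \<and> database S' D' \<and>
        (\<forall>\<tau>\<in>S - {\<sigma>}. same_interp A A' \<tau>) \<and>
        (case \<sigma> of
           Cnst c \<Rightarrow>
             (if S' = S
              then dom A' = dom A \<and> (\<exists>a\<in>dom A. a \<noteq> con A c \<and> con A' c = a)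
              else dom A' = (if free_for A \<sigma> (con A c) then dom A - {con A c} else dom A))
         | _ \<Rightarrow>
             (if S' = S
              then dom A' = dom A \<and> (\<exists>as. length as = width \<sigma> \<and> tup A' \<sigma> = tup A \<sigma> - {as})
              else \<exists>C \<subseteq> {c. (\<exists>as\<in>tup A \<sigma>. c \<in> set as) \<and> free_for A \<sigma> c}. dom A' = dom A - C)))"

definition update_step :: "('s, 'a) database \<Rightarrow> ('s, 'a) database \<Rightarrow> bool" where
  "update_step D D' \<longleftrightarrow> (\<exists>\<sigma>. insertion \<sigma> D D' \<or> deletion \<sigma> D D')"

datatype ('s, 'a) update =
    Finite_Update "('s, 'a) database list"
  | Infinite_Update "nat \<Rightarrow> ('s, 'a) database"

fun update_over :: "('s, 'a) database \<Rightarrow> ('s, 'a) update \<Rightarrow> bool" where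
  "update_over D (Finite_Update Ds) \<longleftrightarrow>
     Ds \<noteq> [] \<and> Ds ! 0 = D \<and> (\<forall>i. Suc i < length Ds \<longrightarrow> update_step (Ds ! i) (Ds ! Suc i))"
| "update_over D (Infinite_Update Ds) \<longleftrightarrow>
     Ds 0 = D \<and> (\<forall>i. update_step (Ds i) (Ds (Suc i)))"

fun satisfactory :: "('s, 'a) update \<Rightarrow> 's fm \<Rightarrow> bool" where
  "satisfactory (Finite_Update Ds) \<phi> \<longleftrightarrow> Ds \<noteq> [] \<and> holds (fst (last Ds)) \<phi>"
| "satisfactory (Infinite_Update Ds) \<phi> \<longleftrightarrow> False"

text \<open>Only used for updates that are satisfactory, hence finite; the values at infinite updates
  are irrelevant.\<close>

fun update_length :: "('s, 'a) update \<Rightarrow> nat" where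
  "update_length (Finite_Update Ds) = length Ds"
| "update_length (Infinite_Update Ds) = 0"

fun update_norm :: "('s, 'a) update \<Rightarrow> 's fm \<Rightarrow> nat" where
  "update_norm (Finite_Update Ds) \<phi> = (LEAST i. i < length Ds \<and> holds (fst (Ds ! i)) \<phi>)"
| "update_norm (Infinite_Update Ds) \<phi> = 0"


section \<open>Complexity, relevancy and informativity\<close>

definition complexity :: "('s, 'a) update set \<Rightarrow> 's fm \<Rightarrow> nat" where
  "complexity \<U> \<phi> =
     (if \<exists>U\<in>\<U>. satisfactory U \<phi>
      then (LEAST k. \<exists>U\<in>\<U>. satisfactory U \<phi> \<and> update_norm U \<phi> = k)
      else 0)"

definition complexity_set :: "('s, 'a) update set \<Rightarrow> 's fm set \<Rightarrow> nat" where
  "complexity_set \<U> \<Gamma> = (\<Sum>\<phi>\<in>\<Gamma>. complexity \<U> \<phi>)"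

text \<open>A deduction is a nonempty list \<open>\<phi>s\<close> together with \<open>k < length \<phi>s\<close>, the index of its last
  premiss.\<close>

definition premisses :: "'s fm list \<Rightarrow> nat \<Rightarrow> 's fm set" where
  "premisses \<phi>s k = set (take (Suc k) \<phi>s)"

definition support :: "'s fm list \<Rightarrow> nat \<Rightarrow> 's fm set" where
  "support \<phi>s k = premisses \<phi>s k \<union> {last \<phi>s}"

definition valid_deduction :: "'a::infinite itself \<Rightarrow> 's fm list \<Rightarrow> nat \<Rightarrow> bool" where
  "valid_deduction u \<phi>s k \<longleftrightarrow>
     consequence u (\<Union>\<phi>\<in>support \<phi>s k. symbols \<phi>) (premisses \<phi>s k) (last \<phi>s)"

definition relevant_part ::
  "('s, 'a::infinite) database \<Rightarrow> ('s, 'a) update \<Rightarrow> 's fm set \<Rightarrow> 's fm set" where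
  "relevant_part D U \<Gamma> =
     {\<phi>\<in>\<Gamma>. satisfactory U \<phi> \<and> \<not> consequence TYPE('a) (sig (fst D)) (snd D) \<phi>}"

definition relevancy ::
  "('s, 'a::infinite) database \<Rightarrow> ('s, 'a) update set \<Rightarrow> 's fm list \<Rightarrow> nat \<Rightarrow> real" where
  "relevancy D \<U> \<phi>s k =
     (if valid_deduction TYPE('a) \<phi>s k \<and> (\<exists>U\<in>\<U>. satisfactory U (last \<phi>s))
      then (let U = (ARG_MIN update_length U. U \<in> \<U> \<and> satisfactory U (last \<phi>s)) in
              real (card (relevant_part D U (support \<phi>s k))) / real (card (support \<phi>s k)))
      else 0)"

definition informativity ::
  "('s, 'a::infinite) database \<Rightarrow> ('s, 'a) update set \<Rightarrow> 's fm list \<Rightarrow> nat \<Rightarrow> real" where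
  "informativity D \<U> \<phi>s k = real (complexity_set \<U> (set \<phi>s)) * relevancy D \<U> \<phi>s k"

definition informativity_prop ::
  "('s, 'a::infinite) database \<Rightarrow> ('s, 'a) update set \<Rightarrow> 's fm \<Rightarrow> real" where
  "informativity_prop D \<U> \<phi> = informativity D \<U> [\<phi>] 0"

end

(* For (i), insert a unary relation symbol P into a database over the empty signature with empty
   theory. The tautology (ALL x. P x) --> (ALL x. P x) becomes true only once P is interpreted, so
   its complexity is 1, and it is not a consequence of the theory over the empty signature; the
   tautology ALL x. x = x already holds at stage 0. For (ii), every stage of an update is a database,
   so no update is satisfactory for a contradiction. *)

theory Submission
  imports Defs
begin

lemma database_update_step:
  assumes "update_step D D'"
  shows "\<exists>S. database S D'"
  using assms unfolding update_step_def insertion_def deletion_def Let_def by blast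

text \<open>No induction is involved: a stage after the first is the target of a step, and both
  kinds of step require their target to be a database. The signature may vary with the stage, hence
  the existential.\<close>

lemma database_update_chain:
  assumes "database S (Ds 0)" and "\<And>i. Suc i < n \<Longrightarrow> update_step (Ds i) (Ds (Suc i))" and "i < n"
  shows "\<exists>S'. database S' (Ds i)"
  using assms(3)
proof (cases i)
  case 0
  then show ?thesis using assms(1) by blast
next
  case (Suc j)
  then show ?thesis using assms(2)[of j] assms(3) database_update_step by blast
qed

text \<open>Infinite updates are never satisfactory by definition. A finite one would make the
  structure of its last stage a model of \<open>\<phi>\<close>.\<close>

lemma not_satisfactory_contradiction:
  fixes D :: "('s, 'a::infinite) database"
  assumes "database S D" and "update_over D U" and "contradiction TYPE('a) \<phi>"
  shows "\<not> satisfactory U \<phi>"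
proof (cases U)
  case (Finite_Update Ds)
  then have "Ds \<noteq> []" "Ds ! 0 = D"
    and "\<And>i. Suc i < length Ds \<Longrightarrow> update_step (Ds ! i) (Ds ! Suc i)"
    using assms(2) by auto
  then obtain S' where "database S' (last Ds)"
    using database_update_chain[of S "\<lambda>i. Ds ! i" "length Ds" "length Ds - 1"] assms(1)
    by (auto simp: last_conv_nth)
  then have "structure_over S' (fst (last Ds))"
    by (simp add: database_def)
  then show ?thesis
    using assms(3) Finite_Update unfolding contradiction_def by auto
qed simp

lemma informativity_prop_contradiction:
  fixes D :: "('s, 'a::infinite) database"
  assumes "database S D" and "\<forall>U\<in>\<U>. update_over D U" and "contradiction TYPE('a) \<phi>"
  shows "informativity_prop D \<U> \<phi> = 0"
proof -
  have "\<not> (\<exists>U\<in>\<U>. satisfactory U \<phi>)"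
    using not_satisfactory_contradiction assms by blast
  \<comment> \<open>Relevancy falls into its default value 0, which annihilates the product.\<close>
  then show ?thesis
    by (simp add: informativity_prop_def informativity_def relevancy_def)
qed

lemma ex_tautologies_zero_pos_informativity:
  "\<exists>(S :: 's symbol set) (D :: ('s, 'a::infinite) database) \<U>.
     signature S \<and> database S D \<and> (\<forall>U\<in>\<U>. update_over D U) \<and>
     (\<exists>\<phi>. tautology TYPE('a) \<phi> \<and> informativity_prop D \<U> \<phi> = 0) \<and>
     (\<exists>\<psi>. tautology TYPE('a) \<psi> \<and> informativity_prop D \<U> \<psi> > 0)"
proof -
  fix r :: 's and a :: 'a
  define A :: "('s, 'a) struct" where
    "A = \<lparr>sig = {}, dom = {a}, con = (\<lambda>_. a), tup = (\<lambda>_. {})\<rparr>"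
  \<comment> \<open>The inserted tuple is \<open>[a]\<close>, so the domain stays
    \<open>{a}\<close>; \<open>tup\<close> matters only at \<open>Rel r 1\<close>.\<close>
  define A' :: "('s, 'a) struct" where
    "A' = \<lparr>sig = {Rel r 1}, dom = {a}, con = (\<lambda>_. a), tup = (\<lambda>_. {[a]})\<rparr>"
  define D :: "('s, 'a) database" where "D = (A, {})"
  define D' :: "('s, 'a) database" where "D' = (A', {})"
  define U where "U = Finite_Update [D, D']"
  define \<phi> :: "'s fm" where "\<phi> = All 0 (Eq (Var 0) (Var 0))"
  define \<psi> :: "'s fm" where
    "\<psi> = Imp (All 0 (Pred r [Var 0])) (All 0 (Pred r [Var 0]))"
  have D: "database {} D"
    by (simp add: database_def structure_over_def signature_def D_def A_def)
  have D': "database {Rel r 1} D'"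
    by (auto simp: database_def structure_over_def signature_def D'_def A'_def)
  have "insertion (Rel r 1) D D'"
    using D' by (auto simp: insertion_def Let_def D_def D'_def A_def A'_def intro!: exI[of _ "[a]"])
  then have U: "update_over D U"
    by (auto simp: U_def update_step_def)
  have taut: "tautology TYPE('a) \<phi>" "tautology TYPE('a) \<psi>"
    by (auto simp: tautology_def sentence_def signature_def structure_over_def holds_def
        \<phi>_def \<psi>_def)
  have "update_norm U \<phi> = 0"
    by (simp add: U_def holds_def \<phi>_def D_def A_def)
  \<comment> \<open>Both branches of the definition give 0: the norm of the only update, and the
    default.\<close>
  then have "complexity {U} \<phi> = 0"
    by (simp add: complexity_def)
  then have "informativity_prop D {U} \<phi> = 0"
    by (simp add: informativity_prop_def informativity_def complexity_set_def)
  moreover have "informativity_prop D {U} \<psi> > 0"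
  proof -
    \<comment> \<open>\<open>sat A e \<psi>\<close> is true; what fails is that \<open>A\<close>
      interprets \<open>Rel r 1\<close>.\<close>
    have not0: "\<not> holds A \<psi>"
      by (simp add: holds_def \<psi>_def A_def)
    have at1: "holds A' \<psi>"
      by (simp add: holds_def \<psi>_def A'_def)
    have sat: "satisfactory U \<psi>"
      using at1 by (simp add: U_def D'_def)
    have "update_norm U \<psi> = 1"
      unfolding U_def update_norm.simps
    proof (rule Least_equality)
      fix i assume "i < length [D, D'] \<and> holds (fst ([D, D'] ! i)) \<psi>"
      then show "1 \<le> i"
        using not0 by (cases i) (auto simp: D_def)
    qed (use at1 in \<open>simp add: D'_def\<close>)
    then have compl: "complexity {U} \<psi> = 1"
      using sat by (auto simp: complexity_def intro: Least_equality)
    \<comment> \<open>The countermodel is \<open>A\<close> itself: it satisfies the empty theory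
      vacuously but does not interpret \<open>\<psi>\<close>.\<close>
    have "\<not> consequence TYPE('a) {} {} \<psi>"
      using D not0 by (auto simp: consequence_def database_def D_def)
    then have "relevant_part D U {\<psi>} = {\<psi>}"
      using sat by (auto simp: relevant_part_def D_def A_def)
    moreover have "valid_deduction TYPE('a) [\<psi>] 0"
      by (simp add: valid_deduction_def consequence_def premisses_def)
    \<comment> \<open>A minimizer exists and satisfies the predicate, which already forces it to be
      \<open>U\<close>.\<close>
    moreover have "(ARG_MIN update_length V. V = U \<and> satisfactory V \<psi>) = U"
      using arg_min_natI[of "\<lambda>V. V = U \<and> satisfactory V \<psi>" U update_length] sat by blast
    \<comment> \<open>Support and relevant part are both \<open>{\<psi>}\<close>, so the quotient is
      1/1.\<close>
    ultimately have "relevancy D {U} [\<psi>] 0 = 1"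
      using sat by (simp add: relevancy_def support_def premisses_def)
    then show ?thesis
      using compl by (simp add: informativity_prop_def informativity_def complexity_set_def)
  qed
  moreover have "signature ({} :: 's symbol set)"
    by (simp add: signature_def)
  moreover have "\<forall>V\<in>{U}. update_over D V"
    using U by simp
  ultimately show ?thesis
    using D taut by blast
qed

theorem theorem5p2:
  shows "(\<exists>(S :: 's symbol set) (D :: ('s, 'a::infinite) database) \<U>.
            signature S \<and> database S D \<and> (\<forall>U\<in>\<U>. update_over D U) \<and>
            (\<exists>\<phi>. tautology TYPE('a) \<phi> \<and> informativity_prop D \<U> \<phi> = 0) \<and>
            (\<exists>\<psi>. tautology TYPE('a) \<psi> \<and> informativity_prop D \<U> \<psi> > 0))
       \<and> (\<forall>(S :: 's symbol set) (D :: ('s, 'a) database) \<U> \<phi>.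
            signature S \<and> database S D \<and> (\<forall>U\<in>\<U>. update_over D U) \<and>
            contradiction TYPE('a) \<phi> \<longrightarrow> informativity_prop D \<U> \<phi> = 0)"
  using ex_tautologies_zero_pos_informativity informativity_prop_contradiction by blast

end
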